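(* Let $0<\lambda\le 1$, let $f\in\mathcal{U}^+(\lambda)$, and let $f^{-1}(w)=w+A_2w^2+A_3w^3+\cdots$ be the expansion of the inverse function of $f$ on the disk $|w|<\frac14$. Then \[ 0\le A_2\le 1+\lambda,\qquad 0\le A_3\le 1+3\lambda+\lambda^2,\qquad 0\le A_4\le (1+\lambda)(1+5\lambda+\lambda^2), \] and all of these estimates (upper and lower) are sharp.
   Context: Let $\mathbb{D}=\{z\in\mathbb{C}:|z|<1\}$ and let $\mathcal{A}$ be the class of functions $f$ analytic in $\mathbb{D}$ of the form $f(z)=z+a_2z^2+a_3z^3+\cdots$. For $0<\lambda\le1$, $\mathcal{U}^+(\lambda)$ is the class of all $f\in\mathcal{A}$ such that \[ \frac{z}{f(z)}=1+b_1z+b_2z^2+\cdots,\qquad b_n\ge 0\ \text{ for all } n\ge1, \] and \[ \left|\left(\frac{z}{f(z)}\right)^2f'(z)-1\right|<\lambda,\qquad z\in\mathbb{D}. \] Every $f\in\mathcal{U}^+(\lambda)$ is univalent in $\mathbb{D}$, so by the Koebe $1/4$ theorem its inverse $f^{-1}$ is defined and analytic on $|w|<\frac14$. "Sharp" means that for each $\lambda\in(0,1]$ equality in the given inequality is attained by some $f\in\mathcal{U}^+(\lambda)$. *)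

theory Defs
  imports "HOL-Complex_Analysis.Complex_Analysis"
begin

definition class_A :: "(complex \<Rightarrow> complex) set" where
  "class_A = {f. f holomorphic_on ball 0 1 \<and> f 0 = 0 \<and> deriv f 0 = 1}"

text \<open>The function \<open>z / f z\<close> on the unit disk, with the removable singularity at the origin
  filled in; for \<open>f\<close> in \<^term>\<open>class_A\<close> its value there is \<open>1\<close>.\<close>

definition z_over :: "(complex \<Rightarrow> complex) \<Rightarrow> complex \<Rightarrow> complex" where
  "z_over f z = (if z = 0 then 1 else z / f z)"

text \<open>Since \<open>z / 0 = 0\<close> in HOL, the condition that \<open>f\<close> has no zero in the disk other than the
  origin, implicit in writing down \<open>z / f z\<close>, is stated separately.\<close>

definition U_plus :: "real \<Rightarrow> (complex \<Rightarrow> complex) set" where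
  "U_plus lam = {f \<in> class_A.
     (\<forall>z \<in> ball 0 1 - {0}. f z \<noteq> 0) \<and>
     (\<exists>b :: nat \<Rightarrow> real. b 0 = 1 \<and> (\<forall>n\<ge>1. b n \<ge> 0) \<and>
        (\<forall>z \<in> ball 0 1. (\<lambda>n. of_real (b n) * z ^ n) sums z_over f z)) \<and>
     (\<forall>z \<in> ball 0 1. norm ((z_over f z)\<^sup>2 * deriv f z - 1) < lam)}"

text \<open>The \<open>n\<close>-th Taylor coefficient at \<open>0\<close> of the inverse of \<open>f\<close> restricted to the unit disk.
  For \<open>f\<close> in \<^term>\<open>U_plus lam\<close> with \<open>0 < lam \<le> 1\<close>, \<open>f\<close> is univalent on the disk and the inverse is
  holomorphic on \<^term>\<open>ball (0 :: complex) (1/4)\<close>, where it is the sum of its Taylor series.\<close>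

definition inv_coeff :: "(complex \<Rightarrow> complex) \<Rightarrow> nat \<Rightarrow> complex" where
  "inv_coeff f n = fps_nth (fps_expansion (the_inv_into (ball 0 1) f) 0) n"

end

(* With g = z/f one has (z/f)^2 f' - 1 = g - z g' - 1 = - sum (n-1) b_n z^n. Letting z tend to 1
   along the radius gives sum (n-1) b_n <= lam, which also yields univalence. As g has no zero on the
   negative radius, g(-r) > 0, and r -> 1 gives b_1 <= 1 + lam. The inverse h satisfies
   h(w) = w g(h(w)), so A_2 = b_1, A_3 = b_2 + b_1^2 and A_4 = b_3 + 3 b_1 b_2 + b_1^3, and what
   remains is elementary. The upper bounds are attained by z / ((1 + z)(1 + lam z)), the lower ones
   by the identity. *)

theory Submission
  imports Defs
begin

section \<open>Power series of z/f and its derivative\<close>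

text \<open>\<open>U_plus\<close> only asserts that coefficients exist. Fixing them as
  \<open>b\<close> lets all lemmas share one sequence and lets the extremal functions be interpreted
  with explicit coefficients.\<close>

locale U_plus_series =
  fixes lam :: real and f :: "complex \<Rightarrow> complex" and b :: "nat \<Rightarrow> real"
  assumes lam: "0 < lam" "lam \<le> 1"
    and f: "f \<in> U_plus lam"
    and b0: "b 0 = 1"
    and b_nonneg: "b n \<ge> 0"
    and b_sums: "norm z < 1 \<Longrightarrow> (\<lambda>n. of_real (b n) * z ^ n) sums z_over f z"
begin

lemma f_holomorphic: "f holomorphic_on ball 0 1"
  using f by (simp add: U_plus_def class_A_def)

lemma f_0: "f 0 = 0"
  using f by (simp add: U_plus_def class_A_def)

lemma f_nonzero: "norm z < 1 \<Longrightarrow> z \<noteq> 0 \<Longrightarrow> f z \<noteq> 0"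
  using f by (simp add: U_plus_def)

lemma z_over_nonzero: "norm z < 1 \<Longrightarrow> z_over f z \<noteq> 0"
  using f_nonzero[of z] by (simp add: z_over_def)

lemma f_eq: "norm z < 1 \<Longrightarrow> f z = z / z_over f z"
  by (simp add: z_over_def f_0)

lemma z_over_deriv:
  assumes "norm z < 1"
  shows "(z_over f has_field_derivative (\<Sum>n. diffs (\<lambda>n. complex_of_real (b n)) n * z ^ n)) (at z)"
proof (rule DERIV_cong_ev[THEN iffD1, OF refl _ refl])
  show "((\<lambda>z. \<Sum>n. of_real (b n) * z ^ n) has_field_derivative
           (\<Sum>n. diffs (\<lambda>n. complex_of_real (b n)) n * z ^ n)) (at z)"
    by (rule termdiffs_strong'[OF _ assms]) (use b_sums sums_summable in blast)
  have "eventually (\<lambda>x. x \<in> ball 0 1) (nhds z)"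
    using assms by (intro eventually_nhds_in_open) auto
  then show "\<forall>\<^sub>F x in nhds z. (\<Sum>n. of_real (b n) * x ^ n) = z_over f x"
    by eventually_elim (use b_sums in \<open>auto simp: sums_iff\<close>)
qed

lemma z_over_deriv_sums:
  assumes "norm z < 1"
  shows "(\<lambda>n. of_nat n * of_real (b n) * z ^ n) sums (z * deriv (z_over f) z)"
proof -
  have "summable (\<lambda>n. diffs (\<lambda>n. complex_of_real (b n)) n * z ^ n)"
    by (rule termdiff_converges[OF assms]) (use b_sums sums_summable in blast)
  then have "(\<lambda>n. diffs (\<lambda>n. complex_of_real (b n)) n * z ^ n) sums deriv (z_over f) z"
    using DERIV_imp_deriv[OF z_over_deriv[OF assms]] by (simp add: summable_sums)
  from sums_mult[OF this, of z]
  have "(\<lambda>n. of_nat (Suc n) * of_real (b (Suc n)) * z ^ Suc n) sums (z * deriv (z_over f) z)"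
    by (simp add: diffs_def mult_ac)
  \<comment> \<open>The term at n = 0 carries the factor n and vanishes, so prepending it does not
    change the sum.\<close>
  then show ?thesis
    by (rule sums_Suc_imp[rotated]) simp
qed

section \<open>The weighted coefficient inequality\<close>

text \<open>Quotient rule for f = z/g with g = \<open>z_over f\<close>: f' = (g - z g')/g^2, and g^2
  cancels because g has no zero in the disk.\<close>

lemma deviation_eq:
  assumes "norm z < 1"
  shows "(z_over f z)\<^sup>2 * deriv f z = z_over f z - z * deriv (z_over f) z"
proof -
  have "((\<lambda>z. z / z_over f z) has_field_derivative
          (z_over f z - z * deriv (z_over f) z) / (z_over f z)\<^sup>2) (at z)"
    using z_over_deriv[OF assms] z_over_nonzero[OF assms]
    by (auto intro!: derivative_eq_intros simp: DERIV_imp_deriv power2_eq_square)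
  moreover have "\<forall>\<^sub>F x in nhds z. x \<in> ball 0 1"
    using assms by (intro eventually_nhds_in_open) auto
  then have "\<forall>\<^sub>F x in nhds z. x / z_over f x = f x"
    by eventually_elim (use f_eq in auto)
  ultimately have "(f has_field_derivative
          (z_over f z - z * deriv (z_over f) z) / (z_over f z)\<^sup>2) (at z)"
    by (simp add: DERIV_cong_ev)
  then show ?thesis
    using z_over_nonzero[OF assms] by (simp add: DERIV_imp_deriv)
qed

text \<open>In z g' - g the coefficient of z^n is (n-1) b_n: it is -1 at n = 0, which moves to the
  right as the constant 1, and 0 at n = 1. Shifting the index by 2 avoids subtraction on
  naturals.\<close>

lemma deviation_sums:
  assumes "norm z < 1"
  shows "(\<lambda>n. of_nat (Suc n) * of_real (b (n + 2)) * z ^ (n + 2)) sums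
           (1 - (z_over f z)\<^sup>2 * deriv f z)"
proof -
  have "(\<lambda>n. of_nat n * of_real (b n) * z ^ n - of_real (b n) * z ^ n) sums
          (z * deriv (z_over f) z - z_over f z)"
    by (intro sums_diff z_over_deriv_sums b_sums assms)
  from sums_split_initial_segment[OF this, of 2]
  have "(\<lambda>n. of_nat (Suc n) * of_real (b (n + 2)) * z ^ (n + 2)) sums
          (1 - (z_over f z - z * deriv (z_over f) z))"
    by (simp add: eval_nat_numeral b0 algebra_simps)
  then show ?thesis
    by (simp only: deviation_eq[OF assms])
qed

text \<open>On the positive radius all terms are nonnegative, so a partial sum is at most the full
  sum, which is below \<open>lam\<close>. A finite sum is continuous in r, so r -> 1 presupposes no
  convergence at 1; summability there follows from this bound.\<close>

lemma deviation_partial_sums: "(\<Sum>n<N. real (Suc n) * b (n + 2)) \<le> lam"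
proof -
  have "(\<Sum>n<N. real (Suc n) * b (n + 2) * r ^ (n + 2)) \<le> lam" if r: "0 < r" "r < 1" for r
  proof -
    have nr: "norm (of_real r :: complex) < 1"
      using r by simp
    define s where "s = 1 - (z_over f (of_real r))\<^sup>2 * deriv f (of_real r)"
    have "(\<lambda>n. complex_of_real (real (Suc n) * b (n + 2) * r ^ (n + 2))) sums s"
      using deviation_sums[OF nr] by (simp add: s_def)
    then have S: "(\<lambda>n. real (Suc n) * b (n + 2) * r ^ (n + 2)) sums Re s"
      using sums_Re by fastforce
    have "norm s < lam"
      using f nr by (simp add: U_plus_def s_def norm_minus_commute)
    then have "Re s < lam"
      using complex_Re_le_cmod[of s] by linarith
    moreover have "(\<Sum>n<N. real (Suc n) * b (n + 2) * r ^ (n + 2)) \<le> Re s"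
      using S r b_nonneg by (subst sums_unique[OF S], intro sum_le_suminf) (auto simp: sums_iff)
    ultimately show ?thesis by simp
  qed
  then have "\<forall>\<^sub>F r in at_left 1. (\<Sum>n<N. real (Suc n) * b (n + 2) * r ^ (n + 2)) \<le> lam"
    using eventually_at_left_real[of 0 "1::real"] by (auto elim: eventually_mono)
  moreover have "((\<lambda>r. \<Sum>n<N. real (Suc n) * b (n + 2) * r ^ (n + 2)) \<longlongrightarrow>
                   (\<Sum>n<N. real (Suc n) * b (n + 2) * 1 ^ (n + 2))) (at_left 1)"
    by (intro tendsto_intros)
  ultimately show ?thesis
    using tendsto_upperbound[of _ _ "at_left (1::real)" lam] by fastforce
qed

lemma weighted_summable: "summable (\<lambda>n. real (Suc n) * b (n + 2))"
proof (rule bounded_imp_summable)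
  show "(\<Sum>k\<le>n. real (Suc k) * b (k + 2)) \<le> lam" for n
    using deviation_partial_sums[of "Suc n"] by (simp only: lessThan_Suc_atMost)
qed (simp add: b_nonneg)

lemma weighted_suminf_le: "(\<Sum>n. real (Suc n) * b (n + 2)) \<le> lam"
  by (rule suminf_le_const[OF weighted_summable deviation_partial_sums])

text \<open>The partial sum of length 2. Controlling b_2 and b_3 jointly is what makes the estimate
  of A_4 sharp.\<close>

lemma b2_b3_le: "b 2 + 2 * b 3 \<le> lam"
  using deviation_partial_sums[of 2] by (simp add: eval_nat_numeral)

section \<open>The bound on b_1\<close>

text \<open>On the real axis g is real and continuous, equals 1 at 0 and never vanishes, so by the
  intermediate value theorem it cannot become nonpositive.\<close>

lemma real_series_pos:
  assumes "0 \<le> r" "r < 1"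
  shows "(\<Sum>n. b n * (- r) ^ n) > 0"
proof (rule ccontr)
  have S: "z_over f (of_real x) = of_real (\<Sum>n. b n * x ^ n)" if "\<bar>x\<bar> < 1" for x
  proof -
    have "(\<lambda>n. complex_of_real (b n * x ^ n)) sums z_over f (of_real x)"
      using b_sums[of "of_real x"] that by simp
    then show ?thesis
      by (metis sums_unique sums_of_real_iff suminf_of_real sums_summable summable_of_real_iff)
  qed
  have "continuous_on (ball 0 1) (z_over f)"
    using z_over_deriv by (intro continuous_at_imp_continuous_on ballI DERIV_isCont) auto
  then have "continuous_on {0..r} (\<lambda>x. z_over f (of_real (- x)))"
    by (rule continuous_on_compose2) (use assms in \<open>auto intro: continuous_intros\<close>)
  then have cont: "continuous_on {0..r} (\<lambda>x. Re (z_over f (of_real (- x))))"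
    by (rule continuous_on_Re)
  assume "\<not> ?thesis"
  then have "Re (z_over f (of_real (- r))) \<le> 0"
    using S[of "- r"] assms by simp
  moreover have "0 \<le> Re (z_over f (of_real (- 0)))"
    by (simp add: z_over_def)
  ultimately obtain x where x: "0 \<le> x" "x \<le> r" "Re (z_over f (of_real (- x))) = 0"
    using IVT2'[OF _ _ _ cont] assms by blast
  \<comment> \<open>By \<open>S\<close> the value is real, so a vanishing real part makes it
    zero.\<close>
  then have "z_over f (of_real (- x)) = 0"
    using S[of "- x"] assms by simp
  moreover have "norm (complex_of_real (- x)) < 1"
    using x assms by simp
  ultimately show False
    using z_over_nonzero by blast
qed

lemma b1_le: "b 1 \<le> 1 + lam"
\<comment> \<open>This rule stands in for the limit r -> 1: it suffices that r b_1 <= 1 + lam for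
  every r in (0,1).\<close>
proof (rule field_le_mult_one_interval)
  fix r :: real assume r: "0 < r" "r < 1"
  have "summable (\<lambda>n. complex_of_real (b n * (- r) ^ n))"
    using b_sums[of "of_real (- r)"] r by (simp add: sums_iff)
  then have sm: "summable (\<lambda>n. b n * (- r) ^ n)"
    by (simp only: summable_of_real_iff)
  \<comment> \<open>The alternating signs are discarded: each power is at most 1, hence at most the
    weight n + 1.\<close>
  have "(\<Sum>n. b (n + 2) * (- r) ^ (n + 2)) \<le> (\<Sum>n. real (Suc n) * b (n + 2))"
  proof (rule suminf_le[OF _ summable_ignore_initial_segment[OF sm] weighted_summable])
    fix n
    have "(- r) ^ (n + 2) \<le> \<bar>(- r) ^ (n + 2)\<bar>"
      by (rule abs_ge_self)
    also have "\<dots> \<le> 1"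
      using power_le_one[of r "n + 2"] r by (simp only: power_abs abs_minus_cancel) simp
    finally have "b (n + 2) * (- r) ^ (n + 2) \<le> b (n + 2) * real (Suc n)"
      by (intro mult_left_mono b_nonneg) simp
    then show "b (n + 2) * (- r) ^ (n + 2) \<le> real (Suc n) * b (n + 2)"
      by (simp add: mult.commute)
  qed
  moreover have "(\<Sum>n. b n * (- r) ^ n) = 1 - r * b 1 + (\<Sum>n. b (n + 2) * (- r) ^ (n + 2))"
    using suminf_split_initial_segment[OF sm, of 2] by (simp add: eval_nat_numeral b0)
  ultimately show "r * b 1 \<le> 1 + lam"
    using real_series_pos[of r] weighted_suminf_le r by simp
qed

section \<open>Univalence\<close>

text \<open>If f x = f y then x g(y) = y g(x). Here the b_1 terms cancel, and y - x equals a series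
  whose norm is at most |xy| |x-y| times the weighted coefficient sum. That sum is at most lam <= 1
  and |xy| < 1, a contradiction.\<close>

lemma f_inj: "inj_on f (ball 0 1)"
proof (rule inj_onI, rule ccontr)
  fix x y assume xy: "x \<in> ball 0 1" "y \<in> ball 0 1" "f x = f y" "x \<noteq> y"
  then have nx: "norm x < 1" "norm y < 1" by auto
  have "x / z_over f x = y / z_over f y"
    using xy(3) unfolding f_eq[OF nx(1)] f_eq[OF nx(2)] .
  then have eq: "x * z_over f y = y * z_over f x"
    by (rule frac_eq_eq[OF z_over_nonzero[OF nx(1)] z_over_nonzero[OF nx(2)], THEN iffD1])
  let ?t = "\<lambda>n. of_real (b n) * (x * y ^ n - y * x ^ n)"
  have "(\<lambda>n. x * (of_real (b n) * y ^ n) - y * (of_real (b n) * x ^ n)) sums 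
          (x * z_over f y - y * z_over f x)"
    by (intro sums_diff sums_mult b_sums nx)
  then have "?t sums 0"
    using eq by (simp add: algebra_simps)
  from sums_split_initial_segment[OF this, of 2]
  have t: "(\<lambda>n. ?t (n + 2)) sums (y - x)"
    by (simp add: eval_nat_numeral b0)
  \<comment> \<open>Factoring out xy leaves y^(n+1) - x^(n+1), which in the unit disk is at most
    (n+1) |y-x|; this produces exactly the weights n + 1.\<close>
  have bd: "norm (?t (n + 2)) \<le> norm (x * y) * norm (x - y) * (real (Suc n) * b (n + 2))" for n
  proof -
    have "?t (n + 2) = of_real (b (n + 2)) * (x * y) * (y ^ Suc n - x ^ Suc n)"
      by (simp add: algebra_simps)
    also have "norm \<dots> = b (n + 2) * norm (x * y) * norm (y ^ Suc n - x ^ Suc n)"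
      by (simp add: norm_mult b_nonneg del: power_Suc)
    also have "\<dots> \<le> b (n + 2) * norm (x * y) * (real (Suc n) * norm (y - x))"
      using nx b_nonneg by (intro mult_left_mono norm_power_diff) auto
    finally show ?thesis
      by (simp add: mult_ac norm_minus_commute)
  qed
  have "norm (y - x) \<le> (\<Sum>n. norm (x * y) * norm (x - y) * (real (Suc n) * b (n + 2)))"
    using bd unfolding sums_unique[OF t] by (intro norm_suminf_le summable_mult weighted_summable)
  also have "\<dots> = norm (x * y) * norm (x - y) * (\<Sum>n. real (Suc n) * b (n + 2))"
    by (rule suminf_mult[OF weighted_summable])
  also have "\<dots> \<le> norm (x * y) * norm (x - y) * 1"
    using weighted_suminf_le lam by (intro mult_left_mono) auto
  also have "\<dots> < 1 * norm (x - y)"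
  proof -
    have "norm (x * y) < 1"
      using mult_strict_mono'[of "norm x" 1 "norm y" 1] nx by (simp add: norm_mult)
    then show ?thesis
      using xy by (simp add: mult_less_cancel_right)
  qed
  finally show False by (simp add: norm_minus_commute)
qed

section \<open>Coefficients of the inverse function\<close>

text \<open>From w = f(z) = z/g(z) one gets h(w) = w g(h(w)) for the inverse h; uniqueness of
  expansions turns this into an identity of formal series.\<close>

lemma inverse_fps_eq:
  defines "H \<equiv> fps_expansion (the_inv_into (ball 0 1) f) 0"
  shows "fps_nth H 0 = 0" "H = fps_X * (Abs_fps (\<lambda>n. of_real (b n)) oo H)"
proof -
  let ?h = "the_inv_into (ball 0 1) f"
  let ?G = "Abs_fps (\<lambda>n. complex_of_real (b n))"
  \<comment> \<open>Holomorphy passes from this \<open>h\<close> to \<open>?h\<close>, which agrees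
    with it on the image. The image is open and contains 0, so \<open>?h\<close> has an expansion
    there.\<close>
  obtain h where h: "h holomorphic_on f ` ball 0 1" "\<And>z. z \<in> ball 0 1 \<Longrightarrow> h (f z) = z"
    using holomorphic_has_inverse[OF f_holomorphic open_ball f_inj] by metis
  have "?h holomorphic_on f ` ball 0 1"
    by (rule holomorphic_transform[OF h(1)]) (auto simp: h(2) the_inv_into_f_f[OF f_inj])
  moreover have op: "open (f ` ball 0 1)"
    by (rule open_mapping_thm3[OF f_holomorphic open_ball f_inj])
  moreover have in0: "0 \<in> f ` ball 0 1"
    using f_0 by (intro image_eqI[of _ _ 0]) auto
  ultimately have H: "?h has_fps_expansion H"
    unfolding H_def by (intro has_fps_expansion_fps_expansion)
  have "?h 0 = 0"
    using the_inv_into_f_f[OF f_inj, of 0] f_0 by simp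
  then show H0: "fps_nth H 0 = 0"
    using has_fps_expansion_imp_0_eq_fps_nth_0[OF H] by simp
  have "\<forall>\<^sub>F u in nhds 0. u \<in> ball (0 :: complex) 1"
    by (intro eventually_nhds_in_open) auto
  then have "\<forall>\<^sub>F u in nhds 0. (\<lambda>n. fps_nth ?G n * u ^ n) sums z_over f u"
    by eventually_elim (use b_sums in auto)
  then have "z_over f has_fps_expansion ?G"
    by (rule has_fps_expansionI)
  then have "(\<lambda>w. w * (z_over f \<circ> ?h) w) has_fps_expansion fps_X * (?G oo H)"
    by (intro has_fps_expansion_mult has_fps_expansion_compose has_fps_expansion_fps_X H H0)
  moreover have "\<forall>\<^sub>F w in nhds 0. w \<in> f ` ball 0 1"
    using op in0 by (intro eventually_nhds_in_open)
  then have "\<forall>\<^sub>F w in nhds 0. w * (z_over f \<circ> ?h) w = ?h w"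
  proof eventually_elim
    case (elim w)
    then obtain z where z: "norm z < 1" "w = f z" by auto
    then have "?h w = z"
      by (simp add: the_inv_into_f_f[OF f_inj])
    then show ?case
      using z f_eq[of z] z_over_nonzero[of z] by simp
  qed
  ultimately have "?h has_fps_expansion fps_X * (?G oo H)"
    by (simp add: has_fps_expansion_cong)
  with H show "H = fps_X * (?G oo H)"
    by (rule fps_expansion_unique_complex)
qed

lemma inv_coeff_values:
  "inv_coeff f 2 = of_real (b 1)"
  "inv_coeff f 3 = of_real (b 2 + (b 1)\<^sup>2)"
  "inv_coeff f 4 = of_real (b 3 + 3 * b 1 * b 2 + b 1 ^ 3)"
proof -
  define H where "H = fps_expansion (the_inv_into (ball 0 1) f) 0"
  note H0 = inverse_fps_eq(1)[folded H_def]
  \<comment> \<open>The factor \<open>fps_X\<close> shifts the index by one, so each coefficient of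
    \<open>H\<close> is determined by the earlier ones.\<close>
  have rec: "fps_nth H (Suc n) = (\<Sum>i=0..n. of_real (b i) * fps_nth (H ^ i) n)" for n
    by (subst inverse_fps_eq(2)[folded H_def]) (simp add: fps_compose_nth)
  note expand = H0 fps_mult_nth sum.atLeast0_atMost_Suc b0 power2_eq_square
  have H1: "fps_nth H (Suc 0) = 1"
    using rec[of 0] by (simp add: b0)
  have H2: "fps_nth H (Suc (Suc 0)) = of_real (b 1)"
    using rec[of 1] H1 by (simp add: expand)
  have H3: "fps_nth H (Suc (Suc (Suc 0))) = of_real (b 2 + (b 1)\<^sup>2)"
    using rec[of "Suc (Suc 0)"] H1 H2 by (simp add: expand numeral_2_eq_2)
  have H4: "fps_nth H (Suc (Suc (Suc (Suc 0)))) = of_real (b 3 + 3 * b 1 * b 2 + b 1 ^ 3)"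
    using rec[of "Suc (Suc (Suc 0))"] H1 H2 H3
    by (simp add: expand numeral_2_eq_2 numeral_3_eq_3 algebra_simps)
  show "inv_coeff f 2 = of_real (b 1)" "inv_coeff f 3 = of_real (b 2 + (b 1)\<^sup>2)"
    "inv_coeff f 4 = of_real (b 3 + 3 * b 1 * b 2 + b 1 ^ 3)"
    using H2 H3 H4 by (simp_all add: inv_coeff_def flip: H_def) (simp_all add: eval_nat_numeral)
qed

text \<open>The first bound is lam + (1 + lam)^2. For the second, inserting b_3 <= (lam - b_2)/2 and
  b_1 <= 1 + lam leaves an expression increasing in b_2, so b_2 = lam is the worst case.\<close>

lemma inv_coeff_bounds:
  "b 2 + (b 1)\<^sup>2 \<le> 1 + 3 * lam + lam\<^sup>2"
  "b 3 + 3 * b 1 * b 2 + b 1 ^ 3 \<le> (1 + lam) * (1 + 5 * lam + lam\<^sup>2)"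
proof -
  have b2: "b 2 \<le> lam"
    using b2_b3_le b_nonneg[of 3] by simp
  have "(b 1)\<^sup>2 \<le> (1 + lam)\<^sup>2"
    by (intro power_mono b1_le b_nonneg)
  then show "b 2 + (b 1)\<^sup>2 \<le> 1 + 3 * lam + lam\<^sup>2"
    using b2 by (simp add: power2_eq_square algebra_simps)
  have "b 1 * b 2 \<le> (1 + lam) * b 2"
    by (intro mult_right_mono b1_le b_nonneg)
  \<comment> \<open>The factor is the total coefficient of b_2: 3 (1 + lam) from the mixed term, and
    -1/2 from the bound on b_3.\<close>
  moreover have "(3 * (1 + lam) - 1 / 2) * b 2 \<le> (3 * (1 + lam) - 1 / 2) * lam"
    using b2 lam by (intro mult_left_mono) auto
  moreover have "b 1 ^ 3 \<le> (1 + lam) ^ 3"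
    by (intro power_mono b1_le b_nonneg)
  ultimately show "b 3 + 3 * b 1 * b 2 + b 1 ^ 3 \<le> (1 + lam) * (1 + 5 * lam + lam\<^sup>2)"
    using b2_b3_le by (simp add: power2_eq_square power3_eq_cube algebra_simps)
qed

end

section \<open>Membership in the class and the extremal functions\<close>

lemma U_plus_imp_series:
  assumes "0 < lam" "lam \<le> 1" "f \<in> U_plus lam"
  obtains b where "U_plus_series lam f b"
proof -
  obtain b where b: "b 0 = (1::real)" "\<forall>n\<ge>1. b n \<ge> 0"
      "\<forall>z\<in>ball 0 1. (\<lambda>n. of_real (b n) * z ^ n) sums z_over f z"
    using assms(3) unfolding U_plus_def by blast
  have "b n \<ge> 0" for n
    using b by (cases "n = 0") auto
  with b assms have "U_plus_series lam f b"
    by unfold_locales auto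
  then show ?thesis by (rule that)
qed

text \<open>With g = 1 + p z + q z^2 the deviation is exactly -q z^2, of norm below lam on the open
  disk. Both extremal functions have this form.\<close>

lemma quadratic_U_plus_series:
  fixes p q lam :: real
  defines "f \<equiv> \<lambda>z. z / (1 + of_real p * z + of_real q * z\<^sup>2)"
  assumes lam: "0 < lam" "lam \<le> 1" and pq: "0 \<le> p" "0 \<le> q" "q \<le> lam"
    and nz: "\<And>z :: complex. norm z < 1 \<Longrightarrow> 1 + of_real p * z + of_real q * z\<^sup>2 \<noteq> 0"
  shows "U_plus_series lam f (\<lambda>n. if n = 0 then 1 else if n = 1 then p else if n = 2 then q else 0)"
    (is "U_plus_series lam f ?b")
proof -
  define g :: "complex \<Rightarrow> complex" where "g = (\<lambda>z. 1 + of_real p * z + of_real q * z\<^sup>2)"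
  \<comment> \<open>The numerator is g - z g', where the terms in p cancel.\<close>
  have D: "(f has_field_derivative (1 - of_real q * z\<^sup>2) / (g z)\<^sup>2) (at z)" if "norm z < 1" for z
    unfolding f_def g_def using nz[OF that]
    by (auto intro!: derivative_eq_intros simp: power2_eq_square algebra_simps)
  have zo: "z_over f z = g z" if "norm z < 1" for z
    using nz[OF that] by (simp add: z_over_def f_def g_def)
  have sums: "(\<lambda>n. of_real (?b n) * z ^ n) sums z_over f z" if "norm z < 1" for z
  proof -
    have "(\<lambda>n. of_real (?b n) * z ^ n) sums (\<Sum>n<3. of_real (?b n) * z ^ n)"
      by (rule sums_finite) auto
    then show ?thesis
      by (simp add: zo[OF that] g_def eval_nat_numeral)
  qed
  have "f holomorphic_on ball 0 1"
    by (auto simp: holomorphic_on_open intro!: exI D)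
  moreover have "deriv f 0 = 1"
    using DERIV_imp_deriv[OF D, of 0] by (simp add: g_def)
  ultimately have "f \<in> class_A"
    by (simp add: class_A_def f_def)
  moreover have "norm ((z_over f z)\<^sup>2 * deriv f z - 1) < lam" if z: "norm z < 1" for z
  proof -
    have "(z_over f z)\<^sup>2 * deriv f z - 1 = - (of_real q * z\<^sup>2)"
      using nz[OF z] by (simp add: DERIV_imp_deriv[OF D[OF z]] zo[OF z] g_def)
    then have "norm ((z_over f z)\<^sup>2 * deriv f z - 1) = q * (norm z)\<^sup>2"
      using pq by (simp add: norm_mult norm_power)
    also have "\<dots> \<le> lam * (norm z)\<^sup>2"
      using pq by (intro mult_right_mono) auto
    also have "\<dots> < lam * 1"
      using lam z by (intro mult_strict_left_mono) (auto simp: abs_square_less_1)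
    finally show ?thesis by simp
  qed
  moreover have "f z \<noteq> 0" if "norm z < 1" "z \<noteq> 0" for z
    using that nz by (simp add: f_def)
  ultimately have "f \<in> U_plus lam"
    using sums pq unfolding U_plus_def
    by (intro CollectI conjI exI[of _ ?b]) auto
  then show ?thesis
    using lam pq sums by unfold_locales auto
qed

theorem theorem1:
  fixes lam :: real
  assumes "0 < lam" and "lam \<le> 1"
  shows "(\<forall>f \<in> U_plus lam.
           (inv_coeff f 2 \<in> \<real> \<and> 0 \<le> Re (inv_coeff f 2) \<and> Re (inv_coeff f 2) \<le> 1 + lam) \<and>
           (inv_coeff f 3 \<in> \<real> \<and> 0 \<le> Re (inv_coeff f 3) \<and> Re (inv_coeff f 3) \<le> 1 + 3 * lam + lam\<^sup>2) \<and>
           (inv_coeff f 4 \<in> \<real> \<and> 0 \<le> Re (inv_coeff f 4) \<and>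
              Re (inv_coeff f 4) \<le> (1 + lam) * (1 + 5 * lam + lam\<^sup>2))) \<and>
         (\<exists>f \<in> U_plus lam. inv_coeff f 2 = 0) \<and>
         (\<exists>f \<in> U_plus lam. inv_coeff f 2 = of_real (1 + lam)) \<and>
         (\<exists>f \<in> U_plus lam. inv_coeff f 3 = 0) \<and>
         (\<exists>f \<in> U_plus lam. inv_coeff f 3 = of_real (1 + 3 * lam + lam\<^sup>2)) \<and>
         (\<exists>f \<in> U_plus lam. inv_coeff f 4 = 0) \<and>
         (\<exists>f \<in> U_plus lam. inv_coeff f 4 = of_real ((1 + lam) * (1 + 5 * lam + lam\<^sup>2)))"
proof -
  have bounds: "(inv_coeff f 2 \<in> \<real> \<and> 0 \<le> Re (inv_coeff f 2) \<and> Re (inv_coeff f 2) \<le> 1 + lam) \<and>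
      (inv_coeff f 3 \<in> \<real> \<and> 0 \<le> Re (inv_coeff f 3) \<and> Re (inv_coeff f 3) \<le> 1 + 3 * lam + lam\<^sup>2) \<and>
      (inv_coeff f 4 \<in> \<real> \<and> 0 \<le> Re (inv_coeff f 4) \<and>
        Re (inv_coeff f 4) \<le> (1 + lam) * (1 + 5 * lam + lam\<^sup>2))" if "f \<in> U_plus lam" for f
  proof -
    obtain b where "U_plus_series lam f b"
      using U_plus_imp_series[OF assms \<open>f \<in> U_plus lam\<close>] .
    then interpret U_plus_series lam f b .
    show ?thesis
      unfolding inv_coeff_values using b1_le inv_coeff_bounds
      by (simp only: Reals_of_real Re_complex_of_real) (simp add: b_nonneg)
  qed
  \<comment> \<open>The identity, written with p = q = 0 to match the quadratic form.\<close>
  define f0 :: "complex \<Rightarrow> complex"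
    where "f0 = (\<lambda>z. z / (1 + of_real 0 * z + of_real 0 * z\<^sup>2))"
  interpret f0: U_plus_series lam f0
    "\<lambda>n. if n = 0 then 1 else if n = 1 then 0 else if n = 2 then 0 else 0"
    unfolding f0_def by (rule quadratic_U_plus_series) (use assms in auto)
  \<comment> \<open>Here b_1 = 1 + lam, b_2 = lam and b_3 = 0, the equality case of all three upper
    bounds at once.\<close>
  define f1 :: "complex \<Rightarrow> complex"
    where "f1 = (\<lambda>z. z / (1 + of_real (1 + lam) * z + of_real lam * z\<^sup>2))"
  \<comment> \<open>The quadratic factors as (1 + z)(1 + lam z); its roots -1 and -1/lam lie outside
    the open disk because lam <= 1.\<close>
  have nz: "1 + of_real (1 + lam) * z + of_real lam * z\<^sup>2 \<noteq> 0" if z: "norm z < 1" for z :: complex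
  proof -
    have "norm (of_real lam * z) \<le> 1 * norm z"
      unfolding norm_mult using assms by (intro mult_right_mono) auto
    then have "z \<noteq> -1" "of_real lam * z \<noteq> -1"
      using z by force+
    then have "1 + z \<noteq> 0" "1 + of_real lam * z \<noteq> 0"
      by (simp_all add: add_eq_0_iff)
    then have "(1 + z) * (1 + of_real lam * z) \<noteq> 0"
      by simp
    then show ?thesis
      by (simp add: algebra_simps power2_eq_square)
  qed
  interpret f1: U_plus_series lam f1
    "\<lambda>n. if n = 0 then 1 else if n = 1 then 1 + lam else if n = 2 then lam else 0"
    unfolding f1_def by (rule quadratic_U_plus_series) (use assms nz in auto)
  have "inv_coeff f0 2 = 0" "inv_coeff f0 3 = 0" "inv_coeff f0 4 = 0"
    by (simp_all add: f0.inv_coeff_values)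
  moreover have "inv_coeff f1 2 = of_real (1 + lam)"
    "inv_coeff f1 3 = of_real (1 + 3 * lam + lam\<^sup>2)"
    "inv_coeff f1 4 = of_real ((1 + lam) * (1 + 5 * lam + lam\<^sup>2))"
    by (simp_all add: f1.inv_coeff_values power2_eq_square power3_eq_cube algebra_simps)
  ultimately show ?thesis
    using bounds f0.f f1.f by blast
qed

end
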